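(* Let $\mathfrak e>d+r+1$ and $\tau_0>0$. Let $F(\varepsilon,\lambda,u)=D(\lambda)u+\varepsilon f(u)$ satisfy the structural assumptions (D), the tame estimates (f1)-(f2) and Hypotheses 1, 2, 3 of the context, with $S'$ large enough, and let $\tau_1,\bar N_0,s_1,S,c(S)$ and $u_\varepsilon$, $\mathcal C_\varepsilon$, $\bar{\mathcal G}^0_N$, $\bar{\mathfrak G}_N$, $\bar{\mathcal I}$, $\tilde{\mathcal I}$ be as in the implicit function theorem recalled in the context. Let $N_0=[\varepsilon^{-1/(S+1)}]$ (integer part) with $\varepsilon$ small enough so that $\varepsilon N_0^S<c(S)$ holds (and $N_0\ge\bar N_0$). Assume in addition that, for all $N\ge N_0$, $$\mathrm{meas}(\mathcal I\setminus\bar{\mathcal G}^0_N)=O(N^{-1}),\qquad \mathrm{meas}(\mathcal I\setminus\bar{\mathfrak G}_N)=O(N^{-1}),\qquad \mathrm{meas}(\mathcal I\setminus(\bar{\mathcal I}\cap\tilde{\mathcal I}))=O(N_0^{-1}).$$ Then, for some $\mathtt K>0$, $$\mathrm{meas}(\mathcal I\setminus\mathcal C_\varepsilon)\le\mathtt K\,\varepsilon^{1/(S+1)}.$$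
   Context: The constants in the $O(\cdot)$ and $\mathtt K$ are independent of $\varepsilon$ and $N$. **Sequence spaces.** Let $\Lambda=\{\sum_{p=1}^rj_p\mathtt w_p: j_p\in\mathbb Z\}\subset\mathbb R^r$ with $\mathtt w_1,\dots,\mathtt w_r\in\mathbb R^r$ linearly independent, and let $\Lambda_+\subset\Lambda$ have the product structure: if $j=\sum j_p\mathtt w_p$, $j'=\sum j'_p\mathtt w_p\in\Lambda_+$ and $\min(j_p,j_p')\le j_p''\le\max(j_p,j_p')$ for all $p$ ($j''_p\in\mathbb Z$), then $\sum j''_p\mathtt w_p\in\Lambda_+$. Let $\mathfrak A$ be a finite set and $\mathfrak K:=\mathbb Z^d\times\Lambda_+\times\mathfrak A$. For $k=(i,\mathfrak a)=(l,j,\mathfrak a)$ put $|l|=\max_p|l_p|$, $|j|=\max_p|j_p|$, $|k|=|i|=\max(|l|,|j|)$, $\langle i\rangle=\max(1,|i|)$. For $k=(i,\mathfrak a),k'=(i',\mathfrak a')$, $\mathrm{dist}(k,k'):=1$ if $i=i',\mathfrak a\ne\mathfrak a'$, and $:=|i-i'|$ otherwise. To each $j\in\Lambda_+$ is associated a multiplicity $d_j\in\mathbb N$, $d_j\ge1$. $H^s$, $s\ge0$, is the Hilbert space of sequences $u=\{u_k\}_{k\in\mathfrak K}$, $u_k\in\mathbb C^{d_j}$, with $\|u\|_s^2=\sum_k\langle w_k\rangle^{2s}\|u_k\|_0^2<\infty$, where $\|\cdot\|_0$ on $\mathbb C^{d_j}$ is the Euclidean norm, $\langle w_k\rangle=\max(c,1,w_k)$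 and $c|k|\le w_k\le C|k|$ for fixed constants $0<c\le C$. **Matrices.** A linear operator is represented by a matrix $M=(M_k^{k'})$ with $M_k^{k'}\in\mathrm{Mat}(d_j\times d_{j'},\mathbb C)$. For $i=(l,j),i'=(l',j')$ let $M_{\{i\}}^{\{i'\}}=(M_{i,\mathfrak a}^{i',\mathfrak a'})_{\mathfrak a,\mathfrak a'\in\mathfrak A}$, and let $\|\cdot\|_0$ denote the $L^2$-operator norm of matrices. The $s$-decay norm is $|M|_s^2:=K_1\sum_{i\in\mathbb Z^d\times\Lambda}[M(i)]^2\langle i\rangle^{2s}$, $[M(i)]:=\sup_{h-h'=i}\|M_{\{h\}}^{\{h'\}}\|_0$ (and $0$ if there are no such $h,h'\in\mathbb Z^d\times\Lambda_+$), with a fixed constant $K_1>4\sum_{i\in\mathbb Z^d\times\Lambda}\langle i\rangle^{-2s_0}$. Here $s_0>(d+r)/2$ is fixed. **Operator (D).** $\varepsilon\ge0$ is small, $\lambda$ ranges in an interval $\mathcal I\subset[1/2,+\infty)$; $D(\lambda)=\mathrm{diag}(D_k(\lambda)\mathbb 1_{d_j})_{k\in\mathfrak K}$, $D_k(\lambda)\in\mathbb C$, satisfies $\|D(\lambda)h\|_s,\|\partial_\lambda D(\lambda)h\|_s\le C(s)\|h\|_{s+\nu}$ for a fixed $\nu>0$. The nonlinearity $f$ is $C^2$ from a neighbourhood of $\{\|u\|_{s_0}\le2\}\subset H^{s_0}$ to $H^{s_0}$ and, given $S'>s_0$, for all $s\in[s_0,S')$ there is $C(s)$ such that for all $\|u\|_{s_0}\le2$: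 (f1) $\|df(u)[h]\|_s\le C(s)(\|u\|_s\|h\|_{s_0}+\|h\|_s)$; (f2) $\|d^2f(u)[h,v]\|_s\le C(s)(\|u\|_s\|h\|_{s_0}\|v\|_{s_0}+\|h\|_s\|v\|_{s_0}+\|h\|_{s_0}\|v\|_s)$. $T(u)$ is the matrix representing $df(u)$, and $L(\varepsilon,\lambda,u)=D(\lambda)+\varepsilon T(u)$. **Hypothesis 1.** A vector $\bar\omega\in\mathbb R^d$ with $|\bar\omega\cdot l|\ge2\gamma_0|l|^{-d}$ for all $l\in\mathbb Z^d\setminus\{0\}$ ($\gamma_0>0$) is fixed, and there are a function $\mathfrak D:\Lambda_+\times\mathfrak A\times\mathbb R\to\mathbb C$ and $\nu_0>0$ such that: $D_{(l,j,\mathfrak a)}(\lambda)=\mathfrak D_{j,\mathfrak a}(\lambda\bar\omega\cdot l)$ for all $\lambda\in\mathcal I$; $T_{(l,j,\mathfrak a)}^{(l',j',\mathfrak a')}=T_{(j,\mathfrak a)}^{(j',\mathfrak a')}(l-l')$; $|T(u)|_{s-\nu_0}\le C(s)(1+\|u\|_s)$; $|T(u)-T(u')|_{s-\nu_0}\le C(s)(\|u-u'\|_s+(\|u\|_s+\|u'\|_s)\|u-u'\|_{s_0})$, for all $\|u\|_{s_0},\|u'\|_{s_0}\le2$ and $s_0+\nu_0<s<S'$. For $\theta\in\mathbb R$ set $D_k(\lambda,\theta):=\mathfrak D_{j,\mathfrak a}(\lambda\bar\omega\cdot l+\theta)$, $D(\lambda,\theta)=\mathrm{diag}(D_k(\lambda,\theta)\mathbb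 1_{d_j})$, $L(\varepsilon,\lambda,\theta,u):=D(\lambda,\theta)+\varepsilon T(u)$. **Hypothesis 2.** There is $\mathfrak n$ such that for all $\tau_1>1$, $N>1$, $\lambda\in\mathcal I$, $(l,j,\mathfrak a)\in\mathfrak K$, the set $\{\theta\in\mathbb R:|D_{(l,j,\mathfrak a)}(\lambda,\theta)|\le N^{-\tau_1}\}$ is contained in a union of $\mathfrak n$ intervals of measure $\le N^{-\tau_1}$. **Hypothesis 3.** A site $k$ is *singular* for $D(\lambda,\theta)$ if $|D_k(\lambda,\theta)|<1$. For $K>1$, $\Sigma_K$ denotes any set of singular sites of $D(\lambda,\theta)$ such that, for every $\tilde\jmath\in\Lambda_+$, at most $K$ elements of $\Sigma_K$ are of the form $(l,\tilde\jmath,\mathfrak a)$. For $\Gamma\ge2$, a $\Gamma$-chain of length $\ell$ is a sequence of distinct $k_0,\dots,k_\ell\in\mathfrak K$ with $\mathrm{dist}(k_{q+1},k_q)\le\Gamma$ for $0\le q\le\ell-1$. The hypothesis: there is a constant $\mathtt s$ and, for any $N_0\ge2$, a set $\tilde{\mathcal I}=\tilde{\mathcal I}(N_0)\subseteq\mathcal I$ such that for all $\lambda\in\tilde{\mathcal I}$, $\theta\in\mathbb R$ and all $K,\Gamma$ with $K\Gamma\ge N_0$, any $\Gamma$-chain of singular sites contained in a set $\Sigma_K$ has length $\ell\le(\Gamma K)^{\mathtt s}$. **Truncations.** $L_{N,j_0}(\varepsilon,\lambda,\theta,u)$ is the submatrix of $L(\varepsilon,\lambda,\theta,u)$ with indices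 in $\{(l,j,\mathfrak a)\in\mathfrak K:|l|\le N,|j-j_0|\le N\}$, and $L_N(\varepsilon,\lambda,u)$ is the submatrix of $L(\varepsilon,\lambda,0,u)$ with indices in $\{k\in\mathfrak K:|k|\le N\}$. Convention: $\|A^{-1}\|_0=+\infty$ if $A$ is not invertible. **Recalled implicit function theorem.** Let $\mathfrak e>d+r+1$ and $\tau_0>0$, and let $F(\varepsilon,\lambda,u)=D(\lambda)u+\varepsilon f(u)$, where $D(\lambda)=\mathrm{diag}(D_k(\lambda)\mathbb 1_{d_j})_{k\in\mathfrak K}$ satisfies $\|D(\lambda)h\|_s,\|\partial_\lambda D(\lambda)h\|_s\le C(s)\|h\|_{s+\nu}$, $f$ is $C^2$ on a neighbourhood of $\{\|u\|_{s_0}\le2\}$ and satisfies the tame estimates (f1)-(f2) for all $s\in[s_0,S')$, and Hypothesis 1 (covariance of $D$; Töplitz in time, off-diagonal decay and Lipschitz properties of $T$), Hypothesis 2 (covering of the set of $\theta$ where $|D_{(l,j,\mathfrak a)}(\lambda,\theta)|$ is small) and Hypothesis 3 (bound on the length of $\Gamma$-chains of singular sites) hold, with $S'$ large enough depending on $\mathfrak e$. Then there are $\tau_1>1$, $\bar N_0\in\mathbb N$, $s_1<S$ in $(s_0+\nu_0,S'-\nu_0)$ and $c(S)>0$ such that for all $N_0\ge\bar N_0$ with $\varepsilon N_0^S<c(S)$ there is $u_\varepsilon\in C^1(\mathcal I,H^{s_1+\nu})$, $u_0(\lambda)=0$, with $F(\varepsilon,\lambda,u_\varepsilon(\lambda))=0$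 for all $\lambda\in\mathcal C_\varepsilon:=\bigcap_{n\ge0}\bar{\mathcal G}^0_{N_0^{2^n}}\cap\bar{\mathfrak G}_{N_0^{2^n}}\cap\tilde{\mathcal I}(N_0)\cap\bar{\mathcal I}$, where $\bar{\mathcal I}=\{\lambda\in\mathcal I:|D_k(\lambda)|\ge N_0^{-\tau_0}\ \forall |k|\le N_0\}$, $\bar{\mathfrak G}_N=\{\lambda\in\mathcal I:\|L_N^{-1}(\varepsilon,\lambda,u_\varepsilon(\lambda))\|_0\le N^{\tau_1}/2\}$, and $\bar{\mathcal G}^0_N$ is the set of $\lambda\in\mathcal I$ such that for all $j_0\in\Lambda_+$ the set $\{\theta\in\mathbb R:\|L^{-1}_{N,j_0}(\varepsilon,\lambda,\theta,u_\varepsilon(\lambda))\|_0>N^{\tau_1}/2\}$ is covered by at most $N^{\mathfrak e}$ intervals of measure $\le N^{-\tau_1}$. *)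

theory Defs
  imports "HOL-Analysis.Analysis" "HOL-Library.Function_Algebras"
begin

section \<open>Index sets\<close>

text \<open>
  A site is \<open>k = (l, j, \<aa>)\<close>. A sequence \<open>u = (u\<^sub>k)\<close> with \<open>u\<^sub>k \<in> \<complex>\<^bsup>d\<^sub>j\<^esup>\<close> is a scalar function of the pairs
  \<open>(k, m)\<close>, \<open>m < d\<^sub>j\<close>, vanishing off these pairs; a matrix \<open>(M\<^sub>k\<^bsup>k'\<^esup>)\<close> with
  \<open>d\<^sub>j \<times> d\<^sub>j\<^sub>'\<close> blocks is a scalar function of two such pairs.
\<close>

type_synonym ('d, 'r) point = "(int ^ 'd) \<times> (real ^ 'r)"
type_synonym ('d, 'r, 'a) site = "(int ^ 'd) \<times> (real ^ 'r) \<times> 'a"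
type_synonym ('d, 'r, 'a) idx = "('d, 'r, 'a) site \<times> nat"
type_synonym ('d, 'r, 'a) sequ = "('d, 'r, 'a) idx \<Rightarrow> complex"
type_synonym ('d, 'r, 'a) matr = "('d, 'r, 'a) idx \<Rightarrow> ('d, 'r, 'a) idx \<Rightarrow> complex"

record ('d, 'r, 'a) problem =
  gen :: "'r \<Rightarrow> real ^ 'r"                  \<comment> \<open>generators \<open>w\<^sub>p\<close> of \<open>\<Lambda>\<close>\<close>
  Lplus :: "(real ^ 'r) set"                \<comment> \<open>\<open>\<Lambda>\<^sub>+\<close>\<close>
  Alph :: "'a set"                          \<comment> \<open>the finite set \<open>\<AA>\<close>\<close>
  mult :: "real ^ 'r \<Rightarrow> nat"               \<comment> \<open>multiplicities \<open>d\<^sub>j\<close>\<close>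
  wgt :: "('d, 'r, 'a) site \<Rightarrow> real"       \<comment> \<open>weights \<open>w\<^sub>k\<close>\<close>
  clow :: real                              \<comment> \<open>\<open>c\<close> and \<open>C\<close> in \<open>c|k| \<le> w\<^sub>k \<le> C|k|\<close>\<close>
  cupp :: real
  s0 :: real
  K1 :: real
  Ival :: "real set"                        \<comment> \<open>the parameter interval\<close>
  Diag :: "real \<Rightarrow> ('d, 'r, 'a) site \<Rightarrow> complex"   \<comment> \<open>\<open>D\<^sub>k(\<lambda>)\<close>\<close>
  nu :: real
  nu0 :: real
  Smax :: real                              \<comment> \<open>\<open>S'\<close>\<close>
  nonlin :: "('d, 'r, 'a) sequ \<Rightarrow> ('d, 'r, 'a) sequ"
  dnonlin :: "('d, 'r, 'a) sequ \<Rightarrow> ('d, 'r, 'a) sequ \<Rightarrow> ('d, 'r, 'a) sequ"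
  ddnonlin :: "('d, 'r, 'a) sequ \<Rightarrow> ('d, 'r, 'a) sequ \<Rightarrow> ('d, 'r, 'a) sequ \<Rightarrow> ('d, 'r, 'a) sequ"
  freq :: "real ^ 'd"                       \<comment> \<open>the Diophantine vector\<close>
  Dfun :: "real ^ 'r \<Rightarrow> 'a \<Rightarrow> real \<Rightarrow> complex"
  Itil :: "nat \<Rightarrow> real set"

definition lattice_pt :: "('r::finite \<Rightarrow> real ^ 'r) \<Rightarrow> int ^ 'r \<Rightarrow> real ^ 'r" where
  "lattice_pt w n = (\<Sum>p\<in>UNIV. of_int (n $ p) *\<^sub>R w p)"

definition lattice :: "('r::finite \<Rightarrow> real ^ 'r) \<Rightarrow> (real ^ 'r) set" where
  "lattice w = range (lattice_pt w)"

definition lattice_coord :: "('r::finite \<Rightarrow> real ^ 'r) \<Rightarrow> real ^ 'r \<Rightarrow> int ^ 'r" where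
  "lattice_coord w j = (THE n. lattice_pt w n = j)"

definition int_norm :: "int ^ 'n::finite \<Rightarrow> real" where
  "int_norm l = Max (range (\<lambda>p. \<bar>of_int (l $ p)\<bar>))"

definition pt_norm :: "('d::finite, 'r::finite, 'a) problem \<Rightarrow> ('d, 'r) point \<Rightarrow> real" where
  "pt_norm P i = max (int_norm (fst i)) (int_norm (lattice_coord (gen P) (snd i)))"

definition pt_bracket :: "('d::finite, 'r::finite, 'a) problem \<Rightarrow> ('d, 'r) point \<Rightarrow> real" where
  "pt_bracket P i = max 1 (pt_norm P i)"

definition pt :: "('d, 'r, 'a) site \<Rightarrow> ('d, 'r) point" where
  "pt k = (fst k, fst (snd k))"

definition sites :: "('d::finite, 'r::finite, 'a) problem \<Rightarrow> ('d, 'r, 'a) site set" where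
  "sites P = UNIV \<times> Lplus P \<times> Alph P"

definition site_dist ::
  "('d::finite, 'r::finite, 'a) problem \<Rightarrow> ('d, 'r, 'a) site \<Rightarrow> ('d, 'r, 'a) site \<Rightarrow> real" where
  "site_dist P k k' = (if pt k = pt k' \<and> k \<noteq> k' then 1 else pt_norm P (pt k - pt k'))"

definition idxs :: "('d::finite, 'r::finite, 'a) problem \<Rightarrow> ('d, 'r, 'a) site set \<Rightarrow> ('d, 'r, 'a) idx set" where
  "idxs P E = {(k, m). k \<in> E \<and> m < mult P (fst (snd k))}"

definition index_assms :: "('d::finite, 'r::finite, 'a) problem \<Rightarrow> bool" where
  "index_assms P \<longleftrightarrow>
     inj (gen P) \<and> independent (range (gen P)) \<and>
     Lplus P \<subseteq> lattice (gen P) \<and>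
     (\<forall>n n' n''. lattice_pt (gen P) n \<in> Lplus P \<longrightarrow> lattice_pt (gen P) n' \<in> Lplus P \<longrightarrow>
        (\<forall>p. min (n $ p) (n' $ p) \<le> n'' $ p \<and> n'' $ p \<le> max (n $ p) (n' $ p)) \<longrightarrow>
        lattice_pt (gen P) n'' \<in> Lplus P) \<and>
     finite (Alph P) \<and>
     (\<forall>j\<in>Lplus P. 1 \<le> mult P j) \<and>
     0 < clow P \<and> clow P \<le> cupp P \<and>
     (\<forall>k\<in>sites P. clow P * pt_norm P (pt k) \<le> wgt P k \<and> wgt P k \<le> cupp P * pt_norm P (pt k)) \<and>
     (real CARD('d) + real CARD('r)) / 2 < s0 P \<and>
     4 * (\<Sum>\<^sub>\<infinity>i\<in>UNIV \<times> lattice (gen P). pt_bracket P i powr (- 2 * s0 P)) < K1 P"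

section \<open>Sequence spaces\<close>

definition wbracket :: "('d::finite, 'r::finite, 'a) problem \<Rightarrow> ('d, 'r, 'a) site \<Rightarrow> real" where
  "wbracket P k = max (clow P) (max 1 (wgt P k))"

definition Hterm ::
  "('d::finite, 'r::finite, 'a) problem \<Rightarrow> real \<Rightarrow> ('d, 'r, 'a) sequ \<Rightarrow> ('d, 'r, 'a) site \<Rightarrow> real" where
  "Hterm P s u k = wbracket P k powr (2 * s) * (\<Sum>m<mult P (fst (snd k)). (cmod (u (k, m)))\<^sup>2)"

definition Hsp :: "('d::finite, 'r::finite, 'a) problem \<Rightarrow> real \<Rightarrow> ('d, 'r, 'a) sequ set" where
  "Hsp P s = {u. (\<forall>b. b \<notin> idxs P (sites P) \<longrightarrow> u b = 0) \<and> Hterm P s u summable_on sites P}"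

definition Hnorm :: "('d::finite, 'r::finite, 'a) problem \<Rightarrow> real \<Rightarrow> ('d, 'r, 'a) sequ \<Rightarrow> real" where
  "Hnorm P s u = sqrt (\<Sum>\<^sub>\<infinity>k\<in>sites P. Hterm P s u k)"

definition ball2 :: "('d::finite, 'r::finite, 'a) problem \<Rightarrow> ('d, 'r, 'a) sequ set" where
  "ball2 P = {u \<in> Hsp P (s0 P). Hnorm P (s0 P) u \<le> 2}"

definition seq_linear ::
  "('d::finite, 'r::finite, 'a) problem \<Rightarrow> real \<Rightarrow> (('d, 'r, 'a) sequ \<Rightarrow> ('d, 'r, 'a) sequ) \<Rightarrow> bool" where
  "seq_linear P s A \<longleftrightarrow>
     (\<forall>h\<in>Hsp P s. \<forall>v\<in>Hsp P s. A (h + v) = A h + A v) \<and>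
     (\<forall>h\<in>Hsp P s. \<forall>a. A (\<lambda>b. a * h b) = (\<lambda>b. a * A h b))"

definition C1_curve ::
  "('d::finite, 'r::finite, 'a) problem \<Rightarrow> real \<Rightarrow> real set \<Rightarrow> (real \<Rightarrow> ('d, 'r, 'a) sequ) \<Rightarrow> bool" where
  "C1_curve P s X v \<longleftrightarrow>
     (\<exists>v'. \<forall>x\<in>X. v x \<in> Hsp P s \<and> v' x \<in> Hsp P s \<and>
        (\<forall>e>0. \<exists>\<delta>>0. \<forall>y\<in>X. \<bar>y - x\<bar> < \<delta> \<longrightarrow>
           Hnorm P s (v y - v x - (\<lambda>b. of_real (y - x) * v' x b)) \<le> e * \<bar>y - x\<bar> \<and>
           Hnorm P s (v' y - v' x) \<le> e))"

section \<open>Matrices\<close>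

text \<open>Euclidean operator norm of the submatrix with rows \<open>E\<close> and columns \<open>E'\<close> (finite sets).\<close>

definition op_norm :: "'i set \<Rightarrow> 'i set \<Rightarrow> ('i \<Rightarrow> 'i \<Rightarrow> complex) \<Rightarrow> real" where
  "op_norm E E' M =
     (SUP x\<in>{x. L2_set (\<lambda>b. cmod (x b)) E' \<le> 1}. L2_set (\<lambda>b. cmod (\<Sum>b'\<in>E'. M b b' * x b')) E)"

definition is_inverse_on :: "'i set \<Rightarrow> ('i \<Rightarrow> 'i \<Rightarrow> complex) \<Rightarrow> ('i \<Rightarrow> 'i \<Rightarrow> complex) \<Rightarrow> bool" where
  "is_inverse_on E M B \<longleftrightarrow>
     (\<forall>b\<in>E. \<forall>b'\<in>E. (\<Sum>c\<in>E. M b c * B c b') = of_bool (b = b') \<and>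
                    (\<Sum>c\<in>E. B b c * M c b') = of_bool (b = b'))"

definition inv_norm :: "'i set \<Rightarrow> ('i \<Rightarrow> 'i \<Rightarrow> complex) \<Rightarrow> ennreal" where
  "inv_norm E M =
     (if \<exists>B. is_inverse_on E M B then ennreal (op_norm E E (SOME B. is_inverse_on E M B)) else \<infinity>)"

definition block :: "('d::finite, 'r::finite, 'a) problem \<Rightarrow> ('d, 'r) point \<Rightarrow> ('d, 'r, 'a) idx set" where
  "block P h = idxs P {k \<in> sites P. pt k = h}"

definition diag_sup ::
  "('d::finite, 'r::finite, 'a) problem \<Rightarrow> ('d, 'r, 'a) matr \<Rightarrow> ('d, 'r) point \<Rightarrow> ennreal" where
  "diag_sup P M i =
     (SUP (h, h')\<in>{(h, h'). h \<in> UNIV \<times> Lplus P \<and> h' \<in> UNIV \<times> Lplus P \<and> h - h' = i}.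
        ennreal (op_norm (block P h) (block P h') M))"

definition decay_norm :: "('d::finite, 'r::finite, 'a) problem \<Rightarrow> real \<Rightarrow> ('d, 'r, 'a) matr \<Rightarrow> ennreal" where
  "decay_norm P s M =
     (let q = ennreal (K1 P) * (\<Sum>\<^sub>\<infinity>i\<in>UNIV \<times> lattice (gen P).
                (diag_sup P M i)\<^sup>2 * ennreal (pt_bracket P i powr (2 * s)))
      in if q = \<infinity> then \<infinity> else ennreal (sqrt (enn2real q)))"

section \<open>The operator and the nonlinearity\<close>

definition diag_op ::
  "(('d, 'r, 'a) site \<Rightarrow> complex) \<Rightarrow> ('d, 'r, 'a) sequ \<Rightarrow> ('d, 'r, 'a) sequ" where
  "diag_op D h = (\<lambda>(k, m). D k * h (k, m))"

definition D_assms :: "('d::finite, 'r::finite, 'a) problem \<Rightarrow> bool" where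
  "D_assms P \<longleftrightarrow>
     is_interval (Ival P) \<and> Ival P \<subseteq> {1/2..} \<and> 0 < nu P \<and>
     (\<exists>D'. (\<forall>k\<in>sites P. \<forall>x\<in>Ival P.
              ((\<lambda>y. Diag P y k) has_vector_derivative D' x k) (at x within Ival P)) \<and>
           (\<forall>s\<ge>0. \<exists>C. \<forall>x\<in>Ival P. \<forall>h\<in>Hsp P (s + nu P).
              diag_op (Diag P x) h \<in> Hsp P s \<and>
              Hnorm P s (diag_op (Diag P x) h) \<le> C * Hnorm P (s + nu P) h \<and>
              diag_op (D' x) h \<in> Hsp P s \<and>
              Hnorm P s (diag_op (D' x) h) \<le> C * Hnorm P (s + nu P) h))"

text \<open>
  The nonlinearity is \<open>C\<^sup>2\<close> on an open set \<open>U\<close> of the complex Hilbert space \<open>H\<^bsup>s0\<^esup>\<close> containing the ball, with Frechet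
  derivatives \<open>dnonlin\<close> and \<open>ddnonlin\<close>; they are complex (bi)linear because the first derivative is
  represented by a complex matrix.
\<close>

definition f_C2 :: "('d::finite, 'r::finite, 'a) problem \<Rightarrow> bool" where
  "f_C2 P \<longleftrightarrow>
     (let H = Hsp P (s0 P); nrm = Hnorm P (s0 P) in
      \<exists>U. ball2 P \<subseteq> U \<and> U \<subseteq> H \<and>
        (\<forall>u\<in>U. \<exists>\<delta>>0. \<forall>h\<in>H. nrm h < \<delta> \<longrightarrow> u + h \<in> U) \<and>
        (\<forall>u\<in>U. nonlin P u \<in> H \<and>
           (\<forall>h\<in>H. dnonlin P u h \<in> H) \<and> seq_linear P (s0 P) (dnonlin P u) \<and>
           (\<exists>B. \<forall>h\<in>H. nrm (dnonlin P u h) \<le> B * nrm h) \<and>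
           (\<forall>h\<in>H. \<forall>v\<in>H. ddnonlin P u h v \<in> H) \<and>
           (\<forall>h\<in>H. seq_linear P (s0 P) (ddnonlin P u h) \<and> seq_linear P (s0 P) (\<lambda>v. ddnonlin P u v h)) \<and>
           (\<exists>B. \<forall>h\<in>H. \<forall>v\<in>H. nrm (ddnonlin P u h v) \<le> B * nrm h * nrm v) \<and>
           (\<forall>e>0. \<exists>\<delta>>0. \<forall>h\<in>H. nrm h < \<delta> \<longrightarrow>
              nrm (nonlin P (u + h) - nonlin P u - dnonlin P u h) \<le> e * nrm h \<and>
              (\<forall>v\<in>H. nrm (dnonlin P (u + h) v - dnonlin P u v - ddnonlin P u h v) \<le> e * nrm h * nrm v) \<and>
              (\<forall>v\<in>H. \<forall>z\<in>H. nrm (ddnonlin P (u + h) v z - ddnonlin P u v z) \<le> e * nrm v * nrm z))))"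

definition f_tame :: "('d::finite, 'r::finite, 'a) problem \<Rightarrow> bool" where
  "f_tame P \<longleftrightarrow>
     s0 P < Smax P \<and>
     (\<forall>s\<in>{s0 P..<Smax P}. \<exists>C. \<forall>u\<in>ball2 P \<inter> Hsp P s. \<forall>h\<in>Hsp P s.
        dnonlin P u h \<in> Hsp P s \<and>
        Hnorm P s (dnonlin P u h) \<le> C * (Hnorm P s u * Hnorm P (s0 P) h + Hnorm P s h) \<and>
        (\<forall>v\<in>Hsp P s.
           ddnonlin P u h v \<in> Hsp P s \<and>
           Hnorm P s (ddnonlin P u h v) \<le>
             C * (Hnorm P s u * Hnorm P (s0 P) h * Hnorm P (s0 P) v
                  + Hnorm P s h * Hnorm P (s0 P) v + Hnorm P (s0 P) h * Hnorm P s v)))"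

definition Tmat :: "('d::finite, 'r::finite, 'a) problem \<Rightarrow> ('d, 'r, 'a) sequ \<Rightarrow> ('d, 'r, 'a) matr" where
  "Tmat P u b b' = dnonlin P u (\<lambda>x. of_bool (x = b')) b"

definition fdot :: "real ^ 'd::finite \<Rightarrow> int ^ 'd \<Rightarrow> real" where
  "fdot om l = (\<Sum>p\<in>UNIV. om $ p * of_int (l $ p))"

definition Dth ::
  "('d::finite, 'r::finite, 'a) problem \<Rightarrow> real \<Rightarrow> real \<Rightarrow> ('d, 'r, 'a) site \<Rightarrow> complex" where
  "Dth P x th k = (case k of (l, j, a) \<Rightarrow> Dfun P j a (x * fdot (freq P) l + th))"

definition Lmat ::
  "('d::finite, 'r::finite, 'a) problem \<Rightarrow> real \<Rightarrow> real \<Rightarrow> real \<Rightarrow> ('d, 'r, 'a) sequ \<Rightarrow> ('d, 'r, 'a) matr" where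
  "Lmat P ep x th u b b' = (if b = b' then Dth P x th (fst b) else 0) + of_real ep * Tmat P u b b'"

definition Fmap ::
  "('d::finite, 'r::finite, 'a) problem \<Rightarrow> real \<Rightarrow> real \<Rightarrow> ('d, 'r, 'a) sequ \<Rightarrow> ('d, 'r, 'a) sequ" where
  "Fmap P ep x u = diag_op (Diag P x) u + (\<lambda>b. of_real ep * nonlin P u b)"

section \<open>Hypotheses\<close>

definition hyp1 :: "('d::finite, 'r::finite, 'a) problem \<Rightarrow> bool" where
  "hyp1 P \<longleftrightarrow>
     (\<exists>g>0. \<forall>l. l \<noteq> 0 \<longrightarrow> 2 * g / int_norm l ^ CARD('d) \<le> \<bar>fdot (freq P) l\<bar>) \<and>
     0 < nu0 P \<and>
     (\<forall>x\<in>Ival P. \<forall>(l, j, a)\<in>sites P. Diag P x (l, j, a) = Dfun P j a (x * fdot (freq P) l)) \<and>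
     (\<forall>u\<in>ball2 P. \<exists>T. \<forall>((l, j, a), m)\<in>idxs P (sites P). \<forall>((l', j', a'), m')\<in>idxs P (sites P).
        Tmat P u ((l, j, a), m) ((l', j', a'), m') = T (j, a, m) (j', a', m') (l - l')) \<and>
     (\<forall>s\<in>{s0 P + nu0 P<..<Smax P}. \<exists>C.
        (\<forall>u\<in>ball2 P \<inter> Hsp P s.
           decay_norm P (s - nu0 P) (Tmat P u) \<le> ennreal (C * (1 + Hnorm P s u))) \<and>
        (\<forall>u\<in>ball2 P \<inter> Hsp P s. \<forall>u'\<in>ball2 P \<inter> Hsp P s.
           decay_norm P (s - nu0 P) (Tmat P u - Tmat P u') \<le>
             ennreal (C * (Hnorm P s (u - u')
                           + (Hnorm P s u + Hnorm P s u') * Hnorm P (s0 P) (u - u')))))"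

definition covered :: "real set \<Rightarrow> real \<Rightarrow> real \<Rightarrow> bool" where
  "covered A n \<rho> \<longleftrightarrow>
     (\<exists>\<J>. finite \<J> \<and> real (card \<J>) \<le> n \<and>
          (\<forall>J\<in>\<J>. is_interval J \<and> emeasure lebesgue J \<le> ennreal \<rho>) \<and> A \<subseteq> \<Union>\<J>)"

definition hyp2 :: "('d::finite, 'r::finite, 'a) problem \<Rightarrow> bool" where
  "hyp2 P \<longleftrightarrow>
     (\<exists>n::nat. \<forall>t>1. \<forall>N::real>1. \<forall>x\<in>Ival P. \<forall>k\<in>sites P.
        covered {th. cmod (Dth P x th k) \<le> N powr (- t)} (real n) (N powr (- t)))"

definition singular_family ::
  "('d::finite, 'r::finite, 'a) problem \<Rightarrow> real \<Rightarrow> real \<Rightarrow> real \<Rightarrow> ('d, 'r, 'a) site set \<Rightarrow> bool" where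
  "singular_family P x th K Sg \<longleftrightarrow>
     Sg \<subseteq> {k \<in> sites P. cmod (Dth P x th k) < 1} \<and>
     (\<forall>j\<in>Lplus P. finite {k \<in> Sg. fst (snd k) = j} \<and> real (card {k \<in> Sg. fst (snd k) = j}) \<le> K)"

definition is_chain ::
  "('d::finite, 'r::finite, 'a) problem \<Rightarrow> real \<Rightarrow> nat \<Rightarrow> (nat \<Rightarrow> ('d, 'r, 'a) site) \<Rightarrow> bool" where
  "is_chain P G len k \<longleftrightarrow>
     k ` {..len} \<subseteq> sites P \<and> inj_on k {..len} \<and> (\<forall>q<len. site_dist P (k (Suc q)) (k q) \<le> G)"

definition hyp3 :: "('d::finite, 'r::finite, 'a) problem \<Rightarrow> bool" where
  "hyp3 P \<longleftrightarrow>
     (\<exists>s::real. \<forall>N0\<ge>2. Itil P N0 \<subseteq> Ival P \<and>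
        (\<forall>x\<in>Itil P N0. \<forall>th. \<forall>K>1. \<forall>G\<ge>2. real N0 \<le> K * G \<longrightarrow>
           (\<forall>Sg len k. singular_family P x th K Sg \<longrightarrow> is_chain P G len k \<longrightarrow> k ` {..len} \<subseteq> Sg \<longrightarrow>
              real len \<le> (G * K) powr s)))"

section \<open>Truncations and the parameter sets\<close>

definition trunc_at ::
  "('d::finite, 'r::finite, 'a) problem \<Rightarrow> nat \<Rightarrow> real ^ 'r \<Rightarrow> ('d, 'r, 'a) idx set" where
  "trunc_at P N j0 =
     idxs P {k \<in> sites P. int_norm (fst k) \<le> N \<and>
                          int_norm (lattice_coord (gen P) (fst (snd k) - j0)) \<le> N}"

definition trunc :: "('d::finite, 'r::finite, 'a) problem \<Rightarrow> nat \<Rightarrow> ('d, 'r, 'a) idx set" where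
  "trunc P N = idxs P {k \<in> sites P. pt_norm P (pt k) \<le> N}"

text \<open>
  Below, \<open>v\<close> stands for the curve \<open>\<lambda> \<mapsto> u\<^sub>\<epsilon>(\<lambda>)\<close>; \<open>good_theta\<close> and \<open>good_inv\<close> are the sets \<open>\<G>\<close> (with the
  exponent \<open>\<ee>\<close>) and \<open>\<GG>\<close> at scale \<open>N\<close>.
\<close>

definition good_theta ::
  "('d::finite, 'r::finite, 'a) problem \<Rightarrow> real \<Rightarrow> real \<Rightarrow> real \<Rightarrow> (real \<Rightarrow> ('d, 'r, 'a) sequ) \<Rightarrow> nat \<Rightarrow> real set" where
  "good_theta P ee t1 ep v N =
     {x \<in> Ival P. \<forall>j0\<in>Lplus P.
        covered {th. inv_norm (trunc_at P N j0) (Lmat P ep x th (v x)) > ennreal (N powr t1 / 2)}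
          (N powr ee) (N powr (- t1))}"

definition good_inv ::
  "('d::finite, 'r::finite, 'a) problem \<Rightarrow> real \<Rightarrow> real \<Rightarrow> (real \<Rightarrow> ('d, 'r, 'a) sequ) \<Rightarrow> nat \<Rightarrow> real set" where
  "good_inv P t1 ep v N =
     {x \<in> Ival P. inv_norm (trunc P N) (Lmat P ep x 0 (v x)) \<le> ennreal (N powr t1 / 2)}"

definition Ibar :: "('d::finite, 'r::finite, 'a) problem \<Rightarrow> real \<Rightarrow> nat \<Rightarrow> real set" where
  "Ibar P t0 N0 =
     {x \<in> Ival P. \<forall>k\<in>sites P. pt_norm P (pt k) \<le> N0 \<longrightarrow> N0 powr (- t0) \<le> cmod (Diag P x k)}"

definition cantor ::
  "('d::finite, 'r::finite, 'a) problem \<Rightarrow> real \<Rightarrow> real \<Rightarrow> real \<Rightarrow> real \<Rightarrow> (real \<Rightarrow> ('d, 'r, 'a) sequ) \<Rightarrow> nat \<Rightarrow> real set" where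
  "cantor P ee t0 t1 ep v N0 =
     (\<Inter>n. good_theta P ee t1 ep v (N0 ^ 2 ^ n) \<inter> good_inv P t1 ep v (N0 ^ 2 ^ n)
          \<inter> Itil P N0 \<inter> Ibar P t0 N0)"

text \<open>
  The constants and the solution produced by the implicit function theorem; the solution is
  \<open>u N0 \<epsilon> \<lambda>\<close>, as it depends on \<open>N0\<close> as well. The bound \<open>2 \<le> Nb\<close> is the range where the sets
  \<open>Itil P N0\<close> are specified.
\<close>

definition ift_solution ::
  "('d::finite, 'r::finite, 'a) problem \<Rightarrow> real \<Rightarrow> real \<Rightarrow> real \<Rightarrow> nat \<Rightarrow> real \<Rightarrow> real \<Rightarrow> real \<Rightarrow>
     (nat \<Rightarrow> real \<Rightarrow> real \<Rightarrow> ('d, 'r, 'a) sequ) \<Rightarrow> bool" where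
  "ift_solution P ee t0 t1 Nb s1 S cS u \<longleftrightarrow>
     1 < t1 \<and> 2 \<le> Nb \<and> s0 P + nu0 P < s1 \<and> s1 < S \<and> S < Smax P - nu0 P \<and> 0 < cS \<and>
     (\<forall>N0\<ge>Nb. \<forall>ep\<ge>0. ep * real N0 powr S < cS \<longrightarrow>
        C1_curve P (s1 + nu P) (Ival P) (u N0 ep) \<and>
        (\<forall>x\<in>Ival P. u N0 0 x = 0) \<and>
        (\<forall>x\<in>cantor P ee t0 t1 ep (u N0 ep) N0. Fmap P ep x (u N0 ep x) = 0))"

definition N_start :: "real \<Rightarrow> real \<Rightarrow> nat" where
  "N_start S ep = nat \<lfloor>ep powr (- 1 / (S + 1))\<rfloor>"

text \<open>
  No regularity is assumed that would make the exceptional sets measurable, and \<open>emeasure\<close> is 0 on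
  non-measurable sets; the outer measure coincides with it on measurable sets.
\<close>

definition meas :: "real set \<Rightarrow> ennreal" where
  "meas A = outer_measure_of lebesgue A"

lemma meas_eq_emeasure: "A \<in> sets lebesgue \<Longrightarrow> meas A = emeasure lebesgue A"
  by (simp add: meas_def)

end

theory Submission
  imports Defs
begin

text \<open>
  The complement of the Cantor-like set is the union of the exceptional sets at the scales
  \<open>N\<^sub>0\<^bsup>2\<^sup>n\<^esup>\<close>. Since \<open>N\<^sub>0\<^bsup>2\<^sup>n\<^esup> \<ge> 2\<^sup>n N\<^sub>0\<close>, their measures sum to \<open>O(N\<^sub>0\<^sup>-\<^sup>1)\<close>, and
  \<open>N\<^sub>0 = [\<epsilon>\<^bsup>-1/(S+1)\<^esup>]\<close> turns this into \<open>O(\<epsilon>\<^bsup>1/(S+1)\<^esup>)\<close>.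
\<close>

lemma meas_mono: "A \<subseteq> B \<Longrightarrow> meas A \<le> meas B"
  unfolding meas_def by (rule outer_measure_of_mono)

lemma meas_attain: "\<exists>E\<in>sets lebesgue. A \<subseteq> E \<and> meas A = emeasure lebesgue E"
  unfolding meas_def by (rule outer_measure_of_attain) simp

text \<open>The exceptional sets need not be measurable. Each \<open>A n\<close> is therefore
  enlarged to a measurable hull \<open>E n\<close> of the same outer measure, where countable
  subadditivity of the Lebesgue measure applies.\<close>

lemma meas_UN_le: "meas (\<Union>n. A n) \<le> (\<Sum>n. meas (A n))" for A :: "nat \<Rightarrow> real set"
proof -
  obtain E where E: "\<And>n. E n \<in> sets lebesgue" "\<And>n. A n \<subseteq> E n"
      "\<And>n. meas (A n) = emeasure lebesgue (E n)"
    using meas_attain[of "A _"] by metis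
  have "meas (\<Union>n. A n) \<le> meas (\<Union>n. E n)"
    using E(2) by (intro meas_mono) blast
  also have "\<dots> = emeasure lebesgue (\<Union>n. E n)"
    using E(1) by (intro meas_eq_emeasure) blast
  also have "\<dots> \<le> (\<Sum>n. emeasure lebesgue (E n))"
    using E(1) by (intro emeasure_subadditive_countably) blast
  finally show ?thesis
    by (simp add: E(3))
qed

lemma meas_Un_le: "meas (A \<union> B) \<le> meas A + meas B"
proof -
  obtain E F where E: "E \<in> sets lebesgue" "A \<subseteq> E" "meas A = emeasure lebesgue E"
      and F: "F \<in> sets lebesgue" "B \<subseteq> F" "meas B = emeasure lebesgue F"
    using meas_attain by metis
  have "meas (A \<union> B) \<le> meas (E \<union> F)"
    using E(2) F(2) by (intro meas_mono) blast
  also have "\<dots> = emeasure lebesgue (E \<union> F)"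
    using E(1) F(1) by (intro meas_eq_emeasure) blast
  also have "\<dots> \<le> meas A + meas B"
    unfolding E(3) F(3) using E(1) F(1) by (rule emeasure_subadditive)
  finally show ?thesis .
qed

text \<open>Trades doubly exponential growth of the scales for geometric growth, which is enough to
  sum bounds of order \<open>1 / N\<close>.\<close>

lemma double_exp_ge:
  fixes M :: nat
  assumes "2 \<le> M"
  shows "2 ^ n * M \<le> M ^ 2 ^ n"
proof -
  have "2 ^ n * M \<le> M ^ n * M"
    using assms by (intro mult_right_mono power_mono) auto
  also have "\<dots> = M ^ Suc n"
    by simp
  \<comment> \<open>The exponents compare by \<open>Suc n \<le> 2 ^ n\<close>.\<close>
  also have "\<dots> \<le> M ^ 2 ^ n"
    using assms Suc_leI[OF less_exp[of n]] by (intro power_increasing) auto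
  finally show ?thesis .
qed

lemma meas_UN_scales_le:
  fixes A :: "nat \<Rightarrow> real set"
  assumes "2 \<le> M" and "0 \<le> C" and A: "\<And>N. M \<le> N \<Longrightarrow> meas (A N) \<le> ennreal (C / real N)"
  shows "meas (\<Union>n. A (M ^ 2 ^ n)) \<le> ennreal (2 * C / real M)"
proof -
  let ?a = "\<lambda>n. C / real M * (1 / 2) ^ n"
  have "meas (A (M ^ 2 ^ n)) \<le> ennreal (?a n)" for n
  proof -
    have scale: "2 ^ n * M \<le> M ^ 2 ^ n"
      using assms(1) by (rule double_exp_ge)
    \<comment> \<open>Every scale is thus at least \<open>M\<close>, the range in which the bound
      \<open>A\<close> is available.\<close>
    have "M \<le> 2 ^ n * M"
      by simp
    with scale have "meas (A (M ^ 2 ^ n)) \<le> ennreal (C / real (M ^ 2 ^ n))"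
      using A order_trans by blast
    also have "\<dots> \<le> ennreal (C / real (2 ^ n * M))"
      using scale assms(1,2)
      by (intro ennreal_leI divide_left_mono of_nat_mono mult_pos_pos) auto
    also have "C / real (2 ^ n * M) = ?a n"
      by (simp add: field_simps)
    finally show ?thesis .
  qed
  then have "meas (\<Union>n. A (M ^ 2 ^ n)) \<le> (\<Sum>n. ennreal (?a n))"
    by (intro order_trans[OF meas_UN_le] suminf_le) auto
  \<comment> \<open>The factor 2 in the conclusion is the sum of the geometric series of ratio
    1/2.\<close>
  also have "?a sums (C / real M * (1 / (1 - 1 / 2)))"
    by (intro sums_mult geometric_sums) simp
  then have "(\<Sum>n. ennreal (?a n)) = ennreal (2 * C / real M)"
    using assms(2) by (simp add: suminf_ennreal2 sums_iff)
  finally show ?thesis .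
qed

text \<open>Rounding down costs at most a factor 2: a real number whose integer part
  \<open>n\<close> is at least 1 is below \<open>n + 1 \<le> 2 * n\<close>.\<close>

lemma inverse_N_start_le:
  assumes "0 < ep" and "1 \<le> N_start S ep"
  shows "1 / real (N_start S ep) \<le> 2 * ep powr (1 / (S + 1))"
proof -
  let ?x = "ep powr (- 1 / (S + 1))"
  have "?x < real (N_start S ep) + 1"
    unfolding N_start_def by linarith
  also have "\<dots> \<le> 2 * real (N_start S ep)"
    using assms(2) by linarith
  finally have "1 / real (N_start S ep) \<le> 2 / ?x"
    using assms by (simp add: field_simps)
  also have "\<dots> = 2 * ep powr (1 / (S + 1))"
    by (simp add: powr_minus_divide)
  finally show ?thesis .
qed

theorem theorem18:
  fixes P :: "('d::finite, 'r::finite, 'a) problem"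
    and ee t0 t1 s1 S cS ep0 :: real
    and Nb :: nat
    and u :: "nat \<Rightarrow> real \<Rightarrow> real \<Rightarrow> ('d, 'r, 'a) sequ"
  assumes "real CARD('d) + real CARD('r) + 1 < ee" and "0 < t0"
    and "index_assms P" and "D_assms P" and "f_C2 P" and "f_tame P"
    and "hyp1 P" and "hyp2 P" and "hyp3 P"
    and "ift_solution P ee t0 t1 Nb s1 S cS u"
    and "0 < ep0"
    and "\<forall>ep\<in>{0<..<ep0}. Nb \<le> N_start S ep \<and> ep * real (N_start S ep) powr S < cS"
    and "\<exists>C>0. \<forall>ep\<in>{0<..<ep0}. \<forall>N\<ge>N_start S ep.
           meas (Ival P - good_theta P ee t1 ep (u (N_start S ep) ep) N) \<le> ennreal (C / real N)"
    and "\<exists>C>0. \<forall>ep\<in>{0<..<ep0}. \<forall>N\<ge>N_start S ep.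
           meas (Ival P - good_inv P t1 ep (u (N_start S ep) ep) N) \<le> ennreal (C / real N)"
    and "\<exists>C>0. \<forall>ep\<in>{0<..<ep0}.
           meas (Ival P - (Ibar P t0 (N_start S ep) \<inter> Itil P (N_start S ep)))
             \<le> ennreal (C / real (N_start S ep))"
  shows "\<exists>K>0. \<forall>ep\<in>{0<..<ep0}.
           meas (Ival P - cantor P ee t0 t1 ep (u (N_start S ep) ep) (N_start S ep))
             \<le> ennreal (K * ep powr (1 / (S + 1)))"
proof -
  have "2 \<le> Nb"
    using assms(10) by (simp add: ift_solution_def)
  \<comment> \<open>The constants are fixed before \<open>ep\<close>, so that \<open>K\<close> is
    uniform in \<open>ep\<close>.\<close>
  obtain C1 C2 C3 where C: "0 < C1" "0 < C2" "0 < C3"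
    and theta: "\<forall>ep\<in>{0<..<ep0}. \<forall>N\<ge>N_start S ep.
      meas (Ival P - good_theta P ee t1 ep (u (N_start S ep) ep) N) \<le> ennreal (C1 / real N)"
    and invb: "\<forall>ep\<in>{0<..<ep0}. \<forall>N\<ge>N_start S ep.
      meas (Ival P - good_inv P t1 ep (u (N_start S ep) ep) N) \<le> ennreal (C2 / real N)"
    and init: "\<forall>ep\<in>{0<..<ep0}.
      meas (Ival P - (Ibar P t0 (N_start S ep) \<inter> Itil P (N_start S ep)))
        \<le> ennreal (C3 / real (N_start S ep))"
    using assms(13-15) by blast
  \<comment> \<open>\<open>C1\<close> and \<open>C2\<close> are doubled by the sum over the scales,
    while \<open>C3\<close> enters once; the outer 2 pays for the integer part in
    \<open>N_start\<close>.\<close>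
  define K where "K = 2 * (2 * C1 + 2 * C2 + C3)"
  have "meas (Ival P - cantor P ee t0 t1 ep (u (N_start S ep) ep) (N_start S ep))
          \<le> ennreal (K * ep powr (1 / (S + 1)))" if ep: "ep \<in> {0<..<ep0}" for ep
  proof -
    define M where "M = N_start S ep"
    define G where "G N = Ival P - good_theta P ee t1 ep (u M ep) N" for N
    define H where "H N = Ival P - good_inv P t1 ep (u M ep) N" for N
    define B where "B = Ival P - (Ibar P t0 M \<inter> Itil P M)"
    have M: "2 \<le> M"
      using assms(12) ep \<open>2 \<le> Nb\<close> unfolding M_def by force
    have "meas (\<Union>n. G (M ^ 2 ^ n)) \<le> ennreal (2 * C1 / real M)"
      using M C theta ep unfolding G_def M_def by (intro meas_UN_scales_le) auto
    moreover have "meas (\<Union>n. H (M ^ 2 ^ n)) \<le> ennreal (2 * C2 / real M)"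
      using M C invb ep unfolding H_def M_def by (intro meas_UN_scales_le) auto
    moreover have "meas B \<le> ennreal (C3 / real M)"
      using init ep unfolding B_def M_def by blast
    \<comment> \<open>\<open>Itil\<close> and \<open>Ibar\<close> do not depend on \<open>n\<close>,
      so a single set \<open>B\<close> accounts for them at all scales.\<close>
    moreover have "Ival P - cantor P ee t0 t1 ep (u M ep) M
        \<subseteq> ((\<Union>n. G (M ^ 2 ^ n)) \<union> (\<Union>n. H (M ^ 2 ^ n))) \<union> B"
      unfolding cantor_def G_def H_def B_def by blast
    ultimately have "meas (Ival P - cantor P ee t0 t1 ep (u M ep) M)
        \<le> ennreal (2 * C1 / real M) + ennreal (2 * C2 / real M) + ennreal (C3 / real M)"
      by (meson add_mono meas_Un_le meas_mono order_trans)
    also have "\<dots> = ennreal ((2 * C1 + 2 * C2 + C3) * (1 / real M))"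
      using C by (simp add: add_divide_distrib flip: ennreal_plus)
    also have "\<dots> \<le> ennreal ((2 * C1 + 2 * C2 + C3) * (2 * ep powr (1 / (S + 1))))"
      using inverse_N_start_le[of ep S] ep M C unfolding M_def
      by (intro ennreal_leI mult_left_mono) auto
    also have "\<dots> = ennreal (K * ep powr (1 / (S + 1)))"
      by (simp add: K_def algebra_simps)
    finally show ?thesis
      unfolding M_def .
  qed
  moreover have "0 < K"
    using C by (simp add: K_def)
  ultimately show ?thesis
    by blast
qed

end
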